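(* There exists an absolute constant $C>0$ such that for all integers $a\ge 0$, $d\ge 1$, $N\ge 1$ with $a\le \left(\frac{Nd-1}{2}\right)^2$ and $a\le \frac{N^2 d}{1800}$, the quantity $\delta_{a,d,N}:=\min\{|a+nd-m^2| : n,m\in\mathbb{Z},\ 0\le n\le N\}$ satisfies $\delta_{a,d,N}\le C\,d^{3/4}$.
   Context: For integers $a\ge 0$, $d\ge 1$, $N\ge 1$, the quantity $\delta_{a,d,N}$ is the smallest distance between a term of the arithmetic progression $a,a+d,\dots,a+Nd$ and a perfect square. The condition $a\le \left(\frac{Nd-1}{2}\right)^2$ is equivalent to $\sqrt{a+Nd}-\sqrt{a}\ge 1$. *)

theory Defs
  imports Complex_Main
begin

definition square_dists :: "int \<Rightarrow> int \<Rightarrow> int \<Rightarrow> int set" where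
  "square_dists a d N = {\<bar>a + n * d - m\<^sup>2\<bar> | n m. 0 \<le> n \<and> n \<le> N}"

(* The set is infinite, so Min does not apply; for N \<ge> 0 it is nonempty and bounded
   below by 0, so its infimum in the integers is attained (see ap_square_dist_attained). *)
definition ap_square_dist :: "int \<Rightarrow> int \<Rightarrow> int \<Rightarrow> int" where
  "ap_square_dist a d N = Inf (square_dists a d N)"

lemma bdd_below_square_dists: "bdd_below (square_dists a d N)"
  by (rule bdd_belowI[of _ 0]) (auto simp: square_dists_def)

lemma square_dists_nonempty:
  assumes "0 \<le> N"
  shows "square_dists a d N \<noteq> {}"
  using assms by (auto simp: square_dists_def)

lemma ap_square_dist_le:
  assumes "0 \<le> n" "n \<le> N"
  shows "ap_square_dist a d N \<le> \<bar>a + n * d - m\<^sup>2\<bar>"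
  unfolding ap_square_dist_def
  by (rule cInf_lower[OF _ bdd_below_square_dists]) (use assms in \<open>auto simp: square_dists_def\<close>)

lemma ap_square_dist_attained:
  assumes "0 \<le> N"
  shows "ap_square_dist a d N \<in> square_dists a d N"
proof -
  from cInf_lessD[OF square_dists_nonempty[OF assms], of a d "ap_square_dist a d N + 1"]
  obtain x where x: "x \<in> square_dists a d N" "x < ap_square_dist a d N + 1"
    by (auto simp: ap_square_dist_def)
  moreover have "ap_square_dist a d N \<le> x"
    unfolding ap_square_dist_def by (rule cInf_lower[OF x(1) bdd_below_square_dists])
  ultimately show ?thesis by (simp add: order_antisym)
qed

end

theory Submission
  imports Defs "HOL-Analysis.Kronecker_Approximation_Theorem"
begin

text \<open>
  Put \<open>w = d powr (1/4)\<close>.  If \<open>sqrt a \<le> 2 * w ^ 3\<close>, then \<open>a\<close> itself is within \<open>2 * sqrt a\<close>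
  of the square below it.  So let \<open>sqrt a > 2 * w ^ 3\<close>; the bound \<open>a \<le> N\<^sup>2 * d / 1800\<close> then
  makes \<open>N\<close> large compared with \<open>w\<close>, so that \<open>[sqrt a, sqrt (a + N * d)]\<close> contains
  more than \<open>4 * sqrt d\<close> consecutive integers.

  The point is that a run \<open>m, m + 1, \<dots>, m + 4 * sqrt d\<close> of integers always has a member
  whose square is within \<open>O(w ^ 3)\<close> of a given residue class modulo \<open>d\<close>.  Dirichlet's theorem
  gives \<open>1 \<le> q \<le> w\<close> for which \<open>2 * m * q\<close> differs from a multiple of \<open>d\<close> by a number \<open>r\<close> with
  \<open>\<bar>r\<bar> = O(w ^ 3)\<close>.  Along the steps \<open>m + q * j\<close> the squares are therefore congruent to
  \<open>m\<^sup>2 + r * j + q\<^sup>2 * j\<^sup>2\<close>.  Consecutive values of this polynomial differ by \<open>O(w ^ 3)\<close>,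
  because \<open>q * j = O(w\<^sup>2)\<close> and \<open>q \<le> w\<close>, whereas its second difference over a length
  \<open>h\<close> with \<open>q * h \<ge> w\<^sup>2\<close> is \<open>2 * (q * h)\<^sup>2 \<ge> 2 * d\<close>, which forces it to vary by at least \<open>d\<close>.
  A slowly varying sequence that covers a full period comes close to every residue class
  (\<open>square_near_residue_class\<close>).

  The square \<open>m\<^sup>2\<close> found in this way lies between \<open>a\<close> and \<open>a + N * d\<close>, so a term of the infinite
  progression that is near it can be replaced by one with index in \<open>{0..N}\<close>
  (\<open>ap_square_dist_le_of_square_between\<close>).
\<close>

text \<open>If no term were within \<open>s\<close> of \<open>t\<close>, a step of size at most \<open>s\<close> could never cross \<open>t\<close>, so
  all terms would stay on one side of it.\<close>

lemma discrete_intermediate_value: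
  fixes f :: "nat \<Rightarrow> int" and s :: real
  assumes "0 \<le> s"
    and step: "\<And>j. j < J \<Longrightarrow> \<bar>real_of_int (f (Suc j) - f j)\<bar> \<le> s"
    and "i \<le> J" "i' \<le> J" "f i \<le> t" "t \<le> f i'"
  shows "\<exists>j\<le>J. \<bar>real_of_int (f j - t)\<bar> \<le> s"
proof (rule ccontr)
  assume "\<not> ?thesis"
  then have far: "\<bar>real_of_int (f j - t)\<bar> > s" if "j \<le> J" for j
    using that by force
  have same_side: "f j \<le> t \<longleftrightarrow> f 0 \<le> t" if "j \<le> J" for j
    using that
  proof (induction j)
    case (Suc j)
    have "\<bar>real_of_int (f j - t)\<bar> > s" "\<bar>real_of_int (f (Suc j) - t)\<bar> > s"
         "\<bar>real_of_int (f (Suc j) - f j)\<bar> \<le> s"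
      using Suc.prems far[of j] far[of "Suc j"] step[of j] by auto
    then have "f (Suc j) \<le> t \<longleftrightarrow> f j \<le> t"
      using \<open>0 \<le> s\<close> by linarith
    with Suc show ?case by simp
  qed simp
  have "f i' \<le> t"
    using same_side[OF \<open>i \<le> J\<close>] same_side[OF \<open>i' \<le> J\<close>] \<open>f i \<le> t\<close> by simp
  then show False
    using far[OF \<open>i' \<le> J\<close>] \<open>t \<le> f i'\<close> \<open>0 \<le> s\<close> by simp
qed

lemma slow_sequence_near_residue_class:
  fixes f :: "nat \<Rightarrow> int" and s :: real
  assumes "0 \<le> s" "1 \<le> d"
    and step: "\<And>j. j < J \<Longrightarrow> \<bar>real_of_int (f (Suc j) - f j)\<bar> \<le> s"
    and "i \<le> J" "i' \<le> J" "f i + d \<le> f i'"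
  shows "\<exists>j\<le>J. \<exists>n. \<bar>real_of_int (f j - (a + n * d))\<bar> \<le> s"
proof -
  \<comment> \<open>The least member of the class of \<open>a\<close> that is at least \<open>f i\<close>.\<close>
  define t where "t = a + (- ((a - f i) div d)) * d"
  have "t = f i + (a - f i) mod d"
    using div_mult_mod_eq[of "a - f i" d] unfolding t_def minus_mult_left[symmetric] by linarith
  moreover have "0 \<le> (a - f i) mod d" "(a - f i) mod d < d"
    using \<open>1 \<le> d\<close> by auto
  ultimately have "f i \<le> t" "t \<le> f i'"
    using \<open>f i + d \<le> f i'\<close> by linarith+
  then obtain j where "j \<le> J" "\<bar>real_of_int (f j - t)\<bar> \<le> s"
    using discrete_intermediate_value[where f = f and J = J] assms by blast
  then show ?thesis
    unfolding t_def by blast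
qed

text \<open>One of the two first differences must be at least half of the second difference.\<close>

lemma large_difference_of_second_difference:
  fixes f :: "nat \<Rightarrow> int"
  assumes "2 * d \<le> f (2 * h) - 2 * f h + f 0"
  shows "\<exists>i\<le>2 * h. \<exists>i'\<le>2 * h. f i + d \<le> f i'"
proof (cases "f h + d \<le> f (2 * h)")
  case True
  then show ?thesis by (intro exI[of _ h] conjI exI[of _ "2 * h"]) auto
next
  case False
  then have "f h + d \<le> f 0" using assms by linarith
  then show ?thesis by (intro exI[of _ h] conjI exI[of _ 0]) auto
qed

lemma Dirichlet_approx_modulus:
  fixes c d :: int and w :: real
  assumes "1 \<le> d" "1 \<le> w"
  obtains q p :: int where "1 \<le> q" "real_of_int q \<le> w" "\<bar>real_of_int (c * q - p * d)\<bar> \<le> 2 * real_of_int d / w"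
proof -
  define Q where "Q = nat \<lfloor>w\<rfloor>"
  have Q: "Q > 0" "real Q \<le> w" "w \<le> 2 * real Q"
  proof -
    have "1 \<le> \<lfloor>w\<rfloor>" using \<open>1 \<le> w\<close> by simp
    then have "real Q = real_of_int \<lfloor>w\<rfloor>" "1 \<le> real_of_int \<lfloor>w\<rfloor>" by (auto simp: Q_def)
    moreover have "real_of_int \<lfloor>w\<rfloor> \<le> w" "w < real_of_int \<lfloor>w\<rfloor> + 1" by linarith+
    ultimately show "Q > 0" "real Q \<le> w" "w \<le> 2 * real Q" by linarith+
  qed
  obtain p q where pq: "0 < q" "q \<le> int Q"
      "\<bar>of_int q * (real_of_int c / real_of_int d) - of_int p\<bar> < 1 / Q"
    using Dirichlet_approx[OF \<open>Q > 0\<close>] by blast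
  have d: "real_of_int d > 0" using \<open>1 \<le> d\<close> by simp
  have "\<bar>real_of_int (c * q - p * d)\<bar>
      = real_of_int d * \<bar>of_int q * (real_of_int c / real_of_int d) - of_int p\<bar>"
    using d by (simp add: abs_mult_pos' right_diff_distrib mult.commute)
  also have "\<dots> \<le> real_of_int d * (1 / Q)"
    using pq(3) d by (intro mult_left_mono) auto
  also have "\<dots> \<le> real_of_int d * (2 / w)"
    using Q d \<open>1 \<le> w\<close> by (intro mult_left_mono) (auto simp: field_simps)
  finally show ?thesis
    using that[of q p] pq Q by (simp add: mult.commute)
qed

text \<open>With \<open>q\<close> from Dirichlet's theorem, moving along \<open>m, m + q, m + 2 * q, \<dots>\<close> changes the squares
  modulo \<open>d\<close> slowly.  The number \<open>2 * h\<close> of steps is chosen so that their curvature alone makes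
  them sweep a full period, whatever the linear coefficient \<open>r\<close> is.\<close>

lemma square_near_residue_class:
  fixes d m a :: int and w :: real
  assumes "1 \<le> d" "1 \<le> w" and w4: "w ^ 4 = real_of_int d"
  shows "\<exists>k n. 0 \<le> k \<and> real_of_int k \<le> 4 * w\<^sup>2 \<and> \<bar>real_of_int ((m + k)\<^sup>2 - (a + n * d))\<bar> \<le> 10 * w ^ 3"
proof -
  obtain q p :: int where q: "1 \<le> q" "real_of_int q \<le> w"
    and qp: "\<bar>real_of_int (2 * m * q - p * d)\<bar> \<le> 2 * real_of_int d / w"
    using Dirichlet_approx_modulus[OF assms(1,2), of "2 * m"] by metis
  define r where "r = 2 * m * q - p * d"
  have "2 * real_of_int d / w = 2 * w ^ 3"
    using \<open>1 \<le> w\<close> by (simp add: w4[symmetric] power4_eq_xxxx power3_eq_cube)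
  with qp have r: "\<bar>real_of_int r\<bar> \<le> 2 * w ^ 3"
    by (simp add: r_def)
  define h where "h = nat \<lceil>w\<^sup>2 / real_of_int q\<rceil>"
  have h: "w\<^sup>2 / real_of_int q \<le> real h" "real h \<le> w\<^sup>2 / real_of_int q + 1"
    unfolding h_def using q by (auto simp: real_nat_ceiling_ge of_nat_ceiling)
  have "w \<le> w\<^sup>2" using \<open>1 \<le> w\<close> by (simp add: power2_eq_square)
  have qh: "w\<^sup>2 \<le> real_of_int q * real h" "real_of_int q * real h \<le> 2 * w\<^sup>2"
  proof -
    show "w\<^sup>2 \<le> real_of_int q * real h" using h(1) q by (simp add: field_simps)
    have "real_of_int q * real h \<le> real_of_int q * (w\<^sup>2 / real_of_int q + 1)"
      using h(2) q by (intro mult_left_mono) auto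
    also have "\<dots> = w\<^sup>2 + real_of_int q" using q by (simp add: field_simps)
    finally show "real_of_int q * real h \<le> 2 * w\<^sup>2" using q \<open>w \<le> w\<^sup>2\<close> by linarith
  qed
  define f where "f j = m\<^sup>2 + r * int j + q\<^sup>2 * (int j)\<^sup>2" for j
  have step: "\<bar>real_of_int (f (Suc j) - f j)\<bar> \<le> 10 * w ^ 3" if "j < 2 * h" for j
  proof -
    have "real_of_int (f (Suc j) - f j) = real_of_int r + real_of_int q * (real_of_int q * (2 * real j + 1))"
      by (simp add: f_def power2_eq_square algebra_simps)
    moreover have "real_of_int q * (real_of_int q * (2 * real j + 1)) \<le> w * (8 * w\<^sup>2)"
    proof (rule mult_mono)
      have "real_of_int q * (2 * real j + 1) \<le> real_of_int q * (4 * real h)"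
        using q that by (intro mult_left_mono) auto
      then show "real_of_int q * (2 * real j + 1) \<le> 8 * w\<^sup>2"
        using qh(2) by linarith
    qed (use q \<open>1 \<le> w\<close> in auto)
    moreover have "0 \<le> real_of_int q * (real_of_int q * (2 * real j + 1))"
      using q by simp
    moreover have "w * (8 * w\<^sup>2) = 8 * w ^ 3"
      by (simp add: power2_eq_square power3_eq_cube)
    ultimately show ?thesis using r by linarith
  qed
  have "d \<le> (q * int h)\<^sup>2"
  proof -
    have "real_of_int d = (w\<^sup>2)\<^sup>2" by (simp flip: w4)
    also have "\<dots> \<le> (real_of_int q * real h)\<^sup>2"
      using qh(1) by (intro power_mono) auto
    also have "\<dots> = real_of_int ((q * int h)\<^sup>2)" by simp
    finally show ?thesis by linarith
  qed
  moreover have "f (2 * h) - 2 * f h + f 0 = 2 * (q * int h)\<^sup>2"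
    by (simp add: f_def power2_eq_square algebra_simps)
  ultimately obtain i i' where "i \<le> 2 * h" "i' \<le> 2 * h" "f i + d \<le> f i'"
    using large_difference_of_second_difference[of d f h] by auto
  then obtain j n where j: "j \<le> 2 * h" and n: "\<bar>real_of_int (f j - (a + n * d))\<bar> \<le> 10 * w ^ 3"
    using slow_sequence_near_residue_class[of "10 * w ^ 3" d "2 * h" f i i' a] step assms by auto
  show ?thesis
  proof (intro exI conjI)
    show "0 \<le> q * int j" using q by simp
    have "real_of_int q * real j \<le> real_of_int q * (2 * real h)"
      using j q by (intro mult_left_mono) auto
    then show "real_of_int (q * int j) \<le> 4 * w\<^sup>2" using qh(2) by simp
    have "(m + q * int j)\<^sup>2 - (a + (n + p * int j) * d) = f j - (a + n * d)"
      by (simp add: f_def r_def power2_eq_square algebra_simps)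
    then show "\<bar>real_of_int ((m + q * int j)\<^sup>2 - (a + (n + p * int j) * d))\<bar> \<le> 10 * w ^ 3"
      using n by (simp only:)
  qed
qed

text \<open>Moving an index outside \<open>{0..N}\<close> to the nearer end of this interval only brings the term
  closer to any point of \<open>[a, a + N * d]\<close>.\<close>

lemma ap_square_dist_le_of_square_between:
  assumes "1 \<le> d" "0 \<le> N" "a \<le> m\<^sup>2" "m\<^sup>2 \<le> a + N * d"
  shows "ap_square_dist a d N \<le> \<bar>m\<^sup>2 - (a + n * d)\<bar>"
proof -
  consider "n < 0" | "0 \<le> n" "n \<le> N" | "N < n" by linarith
  then show ?thesis
  proof cases
    case 1
    then have "n * d \<le> 0" using assms by (simp add: mult_nonpos_nonneg)
    then show ?thesis using ap_square_dist_le[of 0 N a d m] assms by simp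
  next
    case 2
    then show ?thesis using ap_square_dist_le[of n N a d m] by simp
  next
    case 3
    then have "N * d \<le> n * d" using assms by (intro mult_right_mono) auto
    then show ?thesis using ap_square_dist_le[of N N a d m] assms by linarith
  qed
qed

lemma ap_square_dist_le_sqrt:
  assumes "0 \<le> a" "0 \<le> N"
  shows "real_of_int (ap_square_dist a d N) \<le> 2 * sqrt (real_of_int a)"
proof -
  define s where "s = sqrt (real_of_int a)"
  have s: "0 \<le> s" "s\<^sup>2 = real_of_int a" using assms by (auto simp: s_def)
  define e where "e = s - real_of_int \<lfloor>s\<rfloor>"
  have e: "0 \<le> e" "e \<le> 1" "e \<le> s" "real_of_int \<lfloor>s\<rfloor> = s - e"
    using s unfolding e_def by (auto, linarith)
  have "real_of_int (ap_square_dist a d N) \<le> real_of_int \<bar>a + 0 * d - \<lfloor>s\<rfloor>\<^sup>2\<bar>"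
    using ap_square_dist_le[of 0 N a d "\<lfloor>s\<rfloor>"] assms by linarith
  also have "\<dots> = \<bar>s\<^sup>2 - (s - e)\<^sup>2\<bar>" by (simp add: s e(4))
  also have "s\<^sup>2 - (s - e)\<^sup>2 = e * (2 * s - e)" by (simp add: power2_eq_square algebra_simps)
  also have "\<bar>e * (2 * s - e)\<bar> \<le> 1 * (2 * s)"
    unfolding abs_mult using e by (intro mult_mono) auto
  finally show ?thesis by (simp add: s_def)
qed

theorem corollary1:
  "\<exists>C::real. C > 0 \<and>
     (\<forall>a d N :: int. a \<ge> 0 \<longrightarrow> d \<ge> 1 \<longrightarrow> N \<ge> 1 \<longrightarrow>
        real_of_int a \<le> ((real_of_int N * real_of_int d - 1) / 2)\<^sup>2 \<longrightarrow>
        real_of_int a \<le> (real_of_int N)\<^sup>2 * real_of_int d / 1800 \<longrightarrow>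
        real_of_int (ap_square_dist a d N) \<le> C * real_of_int d powr (3 / 4))"
proof (intro exI[of _ 10] conjI allI impI)
  fix a d N :: int
  assume "a \<ge> 0" "d \<ge> 1" "N \<ge> 1"
    and a_le: "real_of_int a \<le> (real_of_int N)\<^sup>2 * real_of_int d / 1800"
  define w where "w = real_of_int d powr (1 / 4)"
  have w: "1 \<le> w" "w ^ 4 = real_of_int d" "w ^ 3 = real_of_int d powr (3 / 4)"
    using \<open>d \<ge> 1\<close> by (auto simp: w_def powr_power ge_one_powr_ge_zero)
  define s where "s = sqrt (real_of_int a)"
  have s: "0 \<le> s" "s\<^sup>2 = real_of_int a" using \<open>a \<ge> 0\<close> by (auto simp: s_def)
  have "real_of_int (ap_square_dist a d N) \<le> 10 * w ^ 3"
  proof (cases "s \<le> 2 * w ^ 3")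
    case True
    moreover have "0 \<le> w ^ 3" using w by simp
    ultimately show ?thesis
      using ap_square_dist_le_sqrt[of a N d] \<open>a \<ge> 0\<close> \<open>N \<ge> 1\<close> unfolding s_def by linarith
  next
    case False
    define m where "m = \<lfloor>s\<rfloor> + 1"
    have m: "s \<le> real_of_int m" "real_of_int m \<le> s + 1" unfolding m_def by linarith+
    obtain k n where k: "0 \<le> k" "real_of_int k \<le> 4 * w\<^sup>2"
      and n: "\<bar>real_of_int ((m + k)\<^sup>2 - (a + n * d))\<bar> \<le> 10 * w ^ 3"
      using square_near_residue_class[OF \<open>d \<ge> 1\<close> w(1,2)] by metis
    have "1 \<le> w\<^sup>2" using w by simp
    \<comment> \<open>\<open>42\<^sup>2 \<le> 1800\<close>.  Since \<open>s > 2 * w ^ 3\<close>, the bound gives \<open>N \<ge> 84 * w\<close>, and these two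
      inequalities pay for the cross term and the square term of \<open>(s + 5 * w\<^sup>2)\<^sup>2\<close>.\<close>
    have s_le: "42 * s \<le> real_of_int N * w\<^sup>2"
    proof (rule power2_le_imp_le)
      have "(42 * s)\<^sup>2 \<le> 1800 * s\<^sup>2" by (simp add: power_mult_distrib)
      also have "\<dots> \<le> (real_of_int N)\<^sup>2 * real_of_int d" using a_le s by simp
      also have "\<dots> = (real_of_int N * w\<^sup>2)\<^sup>2"
        by (simp add: power_mult_distrib flip: w(2))
      finally show "(42 * s)\<^sup>2 \<le> (real_of_int N * w\<^sup>2)\<^sup>2" .
    qed (use \<open>N \<ge> 1\<close> in auto)
    have "84 * w * w\<^sup>2 \<le> real_of_int N * w\<^sup>2"
      using s_le False by (simp add: power2_eq_square power3_eq_cube)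
    then have "84 * w \<le> real_of_int N"
      using w(1) by simp
    then have N: "84 \<le> real_of_int N" using w(1) by linarith
    have "(real_of_int (m + k))\<^sup>2 \<le> (s + 5 * w\<^sup>2)\<^sup>2"
      using m k s \<open>1 \<le> w\<^sup>2\<close> by (intro power_mono) auto
    also have "\<dots> = s\<^sup>2 + 10 * (s * w\<^sup>2) + 25 * w ^ 4"
      by (simp add: power2_eq_square power4_eq_xxxx algebra_simps)
    also have "\<dots> \<le> s\<^sup>2 + real_of_int N * w ^ 4"
    proof -
      have "42 * s * w\<^sup>2 \<le> real_of_int N * w\<^sup>2 * w\<^sup>2"
        using s_le by (intro mult_right_mono) auto
      then have "42 * (s * w\<^sup>2) \<le> real_of_int N * w ^ 4"
        by (simp add: power2_eq_square power4_eq_xxxx mult.assoc)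
      moreover have "84 * w ^ 4 \<le> real_of_int N * w ^ 4"
        using N by (intro mult_right_mono) auto
      moreover have "0 \<le> w ^ 4" by simp
      ultimately show ?thesis by linarith
    qed
    finally have "real_of_int ((m + k)\<^sup>2) \<le> real_of_int (a + N * d)"
      by (simp add: s w)
    then have upper: "(m + k)\<^sup>2 \<le> a + N * d" by linarith
    have "s\<^sup>2 \<le> (real_of_int (m + k))\<^sup>2"
      using m k s by (intro power_mono) auto
    then have "real_of_int a \<le> real_of_int ((m + k)\<^sup>2)" using s by simp
    then have lower: "a \<le> (m + k)\<^sup>2" by linarith
    have "ap_square_dist a d N \<le> \<bar>(m + k)\<^sup>2 - (a + n * d)\<bar>"
      using ap_square_dist_le_of_square_between[OF \<open>d \<ge> 1\<close> _ lower upper] \<open>N \<ge> 1\<close> by simp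
    then have "real_of_int (ap_square_dist a d N) \<le> \<bar>real_of_int ((m + k)\<^sup>2 - (a + n * d))\<bar>"
      by linarith
    then show ?thesis using n by linarith
  qed
  then show "real_of_int (ap_square_dist a d N) \<le> 10 * real_of_int d powr (3 / 4)"
    by (simp add: w)
qed simp

end
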